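(* Let $b\ge 2$ be an integer and let $x=0.a_1a_2a_3\cdots$ (base-$b$ expansion, digits $a_j\in\{0,1,\dots,b-1\}$) be normal to base $b$. Let $(n_i)_{i\ge1}$ be the increasing sequence of positive integers such that a positive integer $n$ equals $n_i$ for some $i$ if and only if $0\le a_n<b-1$. Then the number $0.a_{n_1}a_{n_2}a_{n_3}\cdots$, whose digits lie in $\{0,1,\dots,b-2\}$, is normal to base $b-1$.
   Context: For an integer base $B\ge 1$, a digit sequence $0.d_1d_2d_3\cdots$ with $d_j\in\{0,\dots,B-1\}$ is normal to base $B$ if for every $k\ge1$ and every finite string $[c_1,\dots,c_k]$ of digits in $\{0,\dots,B-1\}$, \[ \lim_{n\to\infty}\frac{\#\{0\le i\le n-1:\ d_{i+j}=c_j \text{ for } 1\le j\le k\}}{n}=\frac{1}{B^k}. \] In words: removing all digits equal to $b-1$ from the base-$b$ expansion of a base-$b$ normal number yields a base-$(b-1)$ normal expansion. *)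

theory Defs
  imports Complex_Main
begin

(* The digit sequence 0.d_1 d_2 d_3 ... is a function nat => nat of which only the values at
   positive arguments matter; d 0 is never used.  Base 1 is allowed. *)

definition digit_seq :: "nat \<Rightarrow> (nat \<Rightarrow> nat) \<Rightarrow> bool" where
  "digit_seq B d \<longleftrightarrow> (\<forall>j\<ge>1. d j \<in> {0..<B})"

(* The string [c_1, ..., c_k] is given by the values of c on {1..k}. *)

definition normal_to_base :: "nat \<Rightarrow> (nat \<Rightarrow> nat) \<Rightarrow> bool" where
  "normal_to_base B d \<longleftrightarrow> digit_seq B d \<and>
     (\<forall>k\<ge>1. \<forall>c :: nat \<Rightarrow> nat. (\<forall>j\<in>{1..k}. c j \<in> {0..<B}) \<longrightarrow>
        (\<lambda>n. real (card {i. i < n \<and> (\<forall>j\<in>{1..k}. d (i + j) = c j)}) / real n)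
          \<longlonglongrightarrow> 1 / real B ^ k)"

(* The sequence (n_i), i \<ge> 1, is the increasing enumeration of the set S of positive integers;
   the value of the function at 0 is irrelevant.  If S is finite, no such sequence exists. *)

definition increasing_enumeration :: "(nat \<Rightarrow> nat) \<Rightarrow> nat set \<Rightarrow> bool" where
  "increasing_enumeration n S \<longleftrightarrow> strict_mono_on {1..} n \<and> n ` {1..} = S"

end

theory Submission
  imports Defs "HOL-Library.FuncSet" "HOL-Library.Infinite_Set"
begin

text \<open>
  Only lower densities need to be estimated. The positions from which the reduced sequence starts
  with \<open>c\<^sub>1 c\<^sub>2 \<dots>\<close> contain, disjointly, those where the next digit is \<open>c\<^sub>1\<close> and the rest of the
  word follows, and those where the next digit is \<open>b - 1\<close> and the whole word follows. Allowing an
  arbitrary prefix of fixed digits, this recursion gives the lower density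
  \<open>b\<^sup>-\<^sup>l (b - 1)\<^sup>-\<^sup>k\<close> for a prefix of length \<open>l\<close> followed by a reduced word of length \<open>k\<close>.
  Dividing by the density of the surviving positions shows that every word of length \<open>k\<close> has lower
  frequency at least \<open>(b - 1)\<^sup>-\<^sup>k\<close> in the reduced sequence; as these bounds add up to 1 over all
  words of length \<open>k\<close>, they are limits.
\<close>

section \<open>Asymptotic lower bounds\<close>

text \<open>This is liminf f \<ge> t, phrased through eventual strict bounds.\<close>

definition lower_limit_ge :: "(nat \<Rightarrow> real) \<Rightarrow> real \<Rightarrow> bool" where
  "lower_limit_ge f t \<longleftrightarrow> (\<forall>s<t. \<forall>\<^sub>F N in sequentially. s < f N)"

lemma lower_limit_geD: "lower_limit_ge f t \<Longrightarrow> s < t \<Longrightarrow> \<forall>\<^sub>F N in sequentially. s < f N"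
  by (simp add: lower_limit_ge_def)

lemma tendsto_imp_lower_limit_ge: "f \<longlonglongrightarrow> t \<Longrightarrow> lower_limit_ge f t"
  by (simp add: lower_limit_ge_def order_tendstoD)

lemma lower_limit_ge_mono:
  assumes "lower_limit_ge f t" and "\<forall>\<^sub>F N in sequentially. f N \<le> g N"
  shows "lower_limit_ge g t"
  unfolding lower_limit_ge_def
proof (intro allI impI)
  fix s assume "s < t"
  from lower_limit_geD[OF assms(1) this] assms(2)
  show "\<forall>\<^sub>F N in sequentially. s < g N" by eventually_elim simp
qed

lemma lower_limit_ge_add:
  assumes "lower_limit_ge f s" and "lower_limit_ge g t"
  shows "lower_limit_ge (\<lambda>N. f N + g N) (s + t)"
  unfolding lower_limit_ge_def
proof (intro allI impI)
  fix r assume "r < s + t"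
  define e where "e = (s + t - r) / 2"
  have "e > 0" and r: "r = (s - e) + (t - e)"
    using \<open>r < s + t\<close> by (auto simp: e_def field_simps)
  have "\<forall>\<^sub>F N in sequentially. s - e < f N" "\<forall>\<^sub>F N in sequentially. t - e < g N"
    using assms \<open>e > 0\<close> by (auto intro: lower_limit_geD)
  then show "\<forall>\<^sub>F N in sequentially. r < f N + g N"
    by eventually_elim (simp add: r)
qed

lemma lower_limit_ge_sum:
  assumes "finite I" and "\<And>i. i \<in> I \<Longrightarrow> lower_limit_ge (f i) (t i)"
  shows "lower_limit_ge (\<lambda>N. \<Sum>i\<in>I. f i N) (\<Sum>i\<in>I. t i)"
  using assms
proof (induction I rule: finite_induct)
  case empty
  show ?case by (simp add: tendsto_imp_lower_limit_ge)
next
  case (insert i I)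
  then show ?case using lower_limit_ge_add[of "f i" "t i"] by simp
qed

text \<open>Lets the number q of recursion steps tend to infinity when each fixed q yields only the
  bound \<open>T q\<close>.\<close>

lemma lower_limit_ge_closed:
  assumes "\<And>q. lower_limit_ge f (T q)" and "T \<longlonglongrightarrow> t"
  shows "lower_limit_ge f t"
  unfolding lower_limit_ge_def
proof (intro allI impI)
  fix s assume "s < t"
  with assms(2) have "\<forall>\<^sub>F q in sequentially. s < T q" by (rule order_tendstoD)
  then obtain q where "s < T q" by (auto simp: eventually_sequentially)
  then show "\<forall>\<^sub>F N in sequentially. s < f N" by (rule lower_limit_geD[OF assms(1)])
qed

lemma lower_limit_ge_compose:
  assumes "lower_limit_ge f t" and "filterlim \<phi> sequentially sequentially"
  shows "lower_limit_ge (\<lambda>N. f (\<phi> N)) t"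
  using assms unfolding lower_limit_ge_def
  by (auto intro: eventually_compose_filterlim[where F = sequentially])

lemma lower_limit_ge_mult:
  assumes f: "lower_limit_ge f t" and g: "g \<longlonglongrightarrow> u" and "u > 0"
  shows "lower_limit_ge (\<lambda>N. f N * g N) (t * u)"
  unfolding lower_limit_ge_def
proof (intro allI impI)
  fix r assume "r < t * u"
  then have "r / u < t" using \<open>u > 0\<close> by (simp add: field_simps)
  \<comment> \<open>An intermediate s leaves slack on both sides: f exceeds s, while s * g still
    tends to s * u > r.\<close>
  then obtain s where s: "r / u < s" "s < t" using dense by blast
  have "r < s * u" using s(1) \<open>u > 0\<close> by (simp add: field_simps)
  moreover have "(\<lambda>N. s * g N) \<longlonglongrightarrow> s * u" by (intro tendsto_intros g)
  ultimately have "\<forall>\<^sub>F N in sequentially. r < s * g N" by (rule order_tendstoD(1)[rotated])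
  moreover have "\<forall>\<^sub>F N in sequentially. 0 < g N" using g \<open>u > 0\<close> by (rule order_tendstoD)
  moreover have "\<forall>\<^sub>F N in sequentially. s < f N" using f s(2) by (rule lower_limit_geD)
  ultimately show "\<forall>\<^sub>F N in sequentially. r < f N * g N"
  proof eventually_elim
    case (elim N)
    have "s * g N < f N * g N" using elim by simp
    with elim show ?case by linarith
  qed
qed

text \<open>Since \<open>f i\<close> is the total minus the other terms, the lower bounds of the
  others cap it from above.\<close>

lemma tendsto_of_lower_limit_ge_sum:
  assumes "finite I" and low: "\<And>i. i \<in> I \<Longrightarrow> lower_limit_ge (f i) (t i)"
    and lim: "(\<lambda>N. \<Sum>i\<in>I. f i N) \<longlonglongrightarrow> (\<Sum>i\<in>I. t i)" and "i \<in> I"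
  shows "f i \<longlonglongrightarrow> t i"
proof (rule order_tendstoI)
  fix s assume "s < t i"
  then show "\<forall>\<^sub>F N in sequentially. s < f i N" by (rule lower_limit_geD[OF low[OF \<open>i \<in> I\<close>]])
next
  fix s assume "t i < s"
  have neg: "lower_limit_ge (\<lambda>N. - (\<Sum>i\<in>I. f i N)) (- (\<Sum>i\<in>I. t i))"
    by (intro tendsto_imp_lower_limit_ge tendsto_minus lim)
  have "lower_limit_ge (\<lambda>N. \<Sum>j\<in>I - {i}. f j N) (\<Sum>j\<in>I - {i}. t j)"
    using assms by (intro lower_limit_ge_sum) auto
  from lower_limit_ge_add[OF this neg] have "lower_limit_ge (\<lambda>N. - f i N) (- t i)"
    using \<open>finite I\<close> \<open>i \<in> I\<close> by (simp add: sum_diff1)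
  then have "\<forall>\<^sub>F N in sequentially. - s < - f i N"
    using \<open>t i < s\<close> by (intro lower_limit_geD) auto
  then show "\<forall>\<^sub>F N in sequentially. f i N < s" by simp
qed

section \<open>Frequencies\<close>

definition freq :: "(nat \<Rightarrow> bool) \<Rightarrow> nat \<Rightarrow> real" where
  "freq P N = real (card {i. i < N \<and> P i}) / real N"

lemma freq_nonneg: "0 \<le> freq P N"
  by (simp add: freq_def)

lemma freq_mono:
  assumes "\<And>i. P i \<Longrightarrow> Q i"
  shows "freq P N \<le> freq Q N"
proof -
  have "card {i. i < N \<and> P i} \<le> card {i. i < N \<and> Q i}"
    using assms by (intro card_mono) auto
  then show ?thesis by (simp add: freq_def divide_right_mono)
qed

lemma freq_disj:
  assumes "\<And>i. \<not> (P i \<and> Q i)"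
  shows "freq (\<lambda>i. P i \<or> Q i) N = freq P N + freq Q N"
proof -
  have "{i. i < N \<and> (P i \<or> Q i)} = {i. i < N \<and> P i} \<union> {i. i < N \<and> Q i}" by auto
  then have "card {i. i < N \<and> (P i \<or> Q i)} = card {i. i < N \<and> P i} + card {i. i < N \<and> Q i}"
    using assms by (simp add: card_Un_disjoint disjoint_iff)
  then show ?thesis by (simp add: freq_def add_divide_distrib)
qed

lemma freq_Bex:
  assumes "finite I" and "\<And>i x y. x \<in> I \<Longrightarrow> y \<in> I \<Longrightarrow> P x i \<Longrightarrow> P y i \<Longrightarrow> x = y"
  shows "freq (\<lambda>i. \<exists>x\<in>I. P x i) N = (\<Sum>x\<in>I. freq (P x) N)"
proof -
  have "{i. i < N \<and> (\<exists>x\<in>I. P x i)} = (\<Union>x\<in>I. {i. i < N \<and> P x i})" by auto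
  then have "card {i. i < N \<and> (\<exists>x\<in>I. P x i)} = (\<Sum>x\<in>I. card {i. i < N \<and> P x i})"
    using assms by (simp, intro card_UN_disjoint) auto
  then show ?thesis by (simp add: freq_def sum_divide_distrib)
qed

lemma freq_True: "(\<lambda>N. freq (\<lambda>_. True) N) \<longlonglongrightarrow> 1"
proof (rule tendsto_eventually)
  \<comment> \<open>At N = 0 the quotient is 0 / 0 = 0, so equality holds only eventually.\<close>
  show "\<forall>\<^sub>F N in sequentially. freq (\<lambda>_. True) N = 1"
    using eventually_gt_at_top[of 0] by eventually_elim (simp add: freq_def)
qed

text \<open>The empty word is included so that prefixes may have length 0.\<close>

lemma normal_to_base_freq:
  assumes "normal_to_base B d" and "\<And>j. j \<in> {1..k} \<Longrightarrow> c j < B"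
  shows "freq (\<lambda>i. \<forall>j\<in>{1..k}. d (i + j) = c j) \<longlonglongrightarrow> 1 / real B ^ k"
proof (cases "k = 0")
  case True
  then show ?thesis using freq_True by simp
next
  case False
  then show ?thesis using assms unfolding normal_to_base_def freq_def by auto
qed

section \<open>Removing the largest digit\<close>

locale reduced_sequence =
  fixes b :: nat and a n :: "nat \<Rightarrow> nat"
  assumes base: "b \<ge> 2"
    and normal: "normal_to_base b a"
    and enum: "increasing_enumeration n {m. m \<ge> 1 \<and> 0 \<le> a m \<and> a m < b - 1}"
begin

text \<open>Counting through position i makes the j-th survivor after it, j \<ge> 1, stand at
  \<open>n (kept_upto i + j)\<close>.\<close>

definition kept_upto :: "nat \<Rightarrow> nat" where
  "kept_upto i = card {r. r < i \<and> a (Suc r) < b - 1}"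

text \<open>A mixed reading after position i: first l digits of the original sequence, then k digits
  of the tail with deletions carried out. The original prefix is what a case split on the next digit
  extends.\<close>

definition occurs :: "nat \<Rightarrow> (nat \<Rightarrow> nat) \<Rightarrow> nat \<Rightarrow> (nat \<Rightarrow> nat) \<Rightarrow> nat \<Rightarrow> bool" where
  "occurs l u k c i \<longleftrightarrow> (\<forall>j\<in>{1..l}. a (i + j) = u j) \<and>
     (\<forall>j\<in>{1..k}. a (n (kept_upto (i + l) + j)) = c j)"

section \<open>Survivor counts and the enumeration\<close>

lemma n_mono: "1 \<le> i \<Longrightarrow> i < j \<Longrightarrow> n i < n j"
  using enum by (auto simp: increasing_enumeration_def strict_mono_on_def)

lemma n_image: "n ` {Suc 0..} = {m. m \<ge> 1 \<and> a m < b - 1}"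
  using enum by (simp add: increasing_enumeration_def)

lemma n_less_iff: "1 \<le> i \<Longrightarrow> 1 \<le> j \<Longrightarrow> n i < n j \<longleftrightarrow> i < j"
  using n_mono by (metis linorder_neqE_nat less_asym less_irrefl)

lemma kept_upto_Suc:
  "kept_upto (Suc i) = (if a (Suc i) < b - 1 then Suc (kept_upto i) else kept_upto i)"
proof -
  have "{r. r < Suc i \<and> a (Suc r) < b - 1} =
    (if a (Suc i) < b - 1 then insert i {r. r < i \<and> a (Suc r) < b - 1}
     else {r. r < i \<and> a (Suc r) < b - 1})"
    by (auto simp: less_Suc_eq)
  then show ?thesis by (simp add: kept_upto_def)
qed

text \<open>The survivors at positions up to \<open>n j\<close> are exactly those at n 1, ..., n j;
  \<open>Suc\<close> turns the counted r into positions.\<close>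

lemma kept_upto_n:
  assumes "1 \<le> j"
  shows "kept_upto (n j) = j"
proof -
  have "Suc ` {r. r < n j \<and> a (Suc r) < b - 1} = n ` {1..j}" (is "?L = ?R")
  proof
    show "?L \<subseteq> ?R"
    proof
      fix m assume "m \<in> ?L"
      then have "m \<in> n ` {1..}" and "m \<le> n j" by (auto simp: n_image)
      then obtain i where "1 \<le> i" "m = n i" by auto
      moreover have "\<not> j < i" using n_less_iff[of j i] assms calculation \<open>m \<le> n j\<close> by auto
      ultimately show "m \<in> ?R" by auto
    qed
    show "?R \<subseteq> ?L"
    proof
      fix m assume "m \<in> ?R"
      then obtain i where i: "1 \<le> i" "i \<le> j" "m = n i" by auto
      then have "n i \<le> n j" using n_mono[of i j] by (cases "i = j") auto
      moreover have "m \<in> n ` {1..}" using i by auto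
      ultimately have "m = Suc (m - 1)" "m - 1 < n j" "a m < b - 1"
        using i by (auto simp: n_image)
      then show "m \<in> ?L" by (intro image_eqI[of _ _ "m - 1"]) auto
    qed
  qed
  then have "kept_upto (n j) = card (n ` {1..j})"
    by (metis kept_upto_def card_image inj_Suc)
  also have "inj_on n {1..j}"
    by (rule inj_onI) (metis atLeastAtMost_iff less_irrefl linorder_neqE_nat n_mono)
  then have "card (n ` {1..j}) = j" by (simp add: card_image)
  finally show ?thesis .
qed

text \<open>The surviving position \<open>Suc i\<close> is some \<open>n j\<close>, and evaluating
  \<open>kept_upto\<close> there recovers j.\<close>

lemma n_kept_upto:
  assumes "a (Suc i) < b - 1"
  shows "n (Suc (kept_upto i)) = Suc i"
proof -
  have "Suc i \<in> n ` {1..}" using assms by (simp add: n_image)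
  then obtain j where "1 \<le> j" "Suc i = n j" by auto
  with kept_upto_n[of j] kept_upto_Suc[of i] assms show ?thesis by auto
qed

section \<open>Lower densities by branching on the next original digit\<close>

lemma occurs_last:
  assumes "occurs (Suc l) (u(Suc l := x)) k c i"
  shows "a (Suc (i + l)) = x"
  using assms[unfolded occurs_def, THEN conjunct1, THEN bspec, of "Suc l"] by simp

text \<open>The prefix digit \<open>c 1\<close> survives, so it is the first survivor after position
  i + l, and the rest of the word is read from the next position on.\<close>

lemma occurs_kept:
  assumes "occurs (Suc l) (u(Suc l := c 1)) k (\<lambda>j. c (Suc j)) i" and "c 1 < b - 1"
  shows "occurs l u (Suc k) c i"
proof -
  have *: "a (Suc (i + l)) = c 1" using assms(1) by (rule occurs_last)
  have u: "\<forall>j\<in>{1..l}. a (i + j) = u j"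
    and c: "\<forall>j\<in>{1..k}. a (n (kept_upto (Suc (i + l)) + j)) = c (Suc j)"
    using assms(1) by (simp_all add: occurs_def)
  have "a (n (kept_upto (i + l) + j)) = c j" if j: "j \<in> {1..Suc k}" for j
  proof (cases "j = 1")
    case True
    then show ?thesis using n_kept_upto[of "i + l"] * assms(2) by simp
  next
    case False
    then have "j - 1 \<in> {1..k}" using j by auto
    \<comment> \<open>The count grows by one at the kept digit, so index j - 1 after it is index j
      before it.\<close>
    from bspec[OF c this] show ?thesis using False j * assms(2) by (simp add: kept_upto_Suc)
  qed
  with u show ?thesis by (auto simp: occurs_def)
qed

text \<open>A deleted digit leaves \<open>kept_upto\<close> unchanged, so the same survivors
  follow.\<close>

lemma occurs_removed:
  assumes "occurs (Suc l) (u(Suc l := b - 1)) k c i"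
  shows "occurs l u k c i"
proof -
  have "\<forall>j\<in>{1..l}. a (i + j) = u j"
    and "\<forall>j\<in>{1..k}. a (n (kept_upto (Suc (i + l)) + j)) = c j"
    using assms by (simp_all add: occurs_def)
  with occurs_last[OF assms] show ?thesis by (simp add: occurs_def kept_upto_Suc)
qed

lemma occurs_lower_density:
  assumes "\<And>j. j \<in> {1..k} \<Longrightarrow> c j < b - 1" and "\<And>j. j \<in> {1..l} \<Longrightarrow> u j < b"
  shows "lower_limit_ge (freq (occurs l u k c)) (1 / real (b - 1) ^ k / real b ^ l)"
  using assms
proof (induction k arbitrary: c l u)
  case 0
  have "freq (occurs l u 0 c) \<longlonglongrightarrow> 1 / real b ^ l"
    using normal_to_base_freq[OF normal 0(2), of l "\<lambda>j. j"] by (simp add: occurs_def[abs_def])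
  then show ?case by (simp add: tendsto_imp_lower_limit_ge)
next
  case (Suc k)
  \<comment> \<open>\<open>T q / real b ^ l\<close> is the expected density of occurrences with
    fewer than q deleted digits between the prefix and the first letter: the geometric sum of 1 /
    b^(r + 1) over r < q, times 1 / (b - 1)^k for the remaining k letters and 1 / b^l for the
    prefix.\<close>
  define T where "T q = (1 - (1 / real b) ^ q) / real (b - 1) ^ Suc k" for q
  note tail_bound = Suc.IH and c_digit = Suc.prems(1)
  have c1: "c 1 < b - 1" using c_digit by simp
  have T_Suc: "T (Suc q) = (1 / real (b - 1) ^ k + T q) / real b" for q
  proof -
    define m x where "m = real (b - 1)" and "x = (1 / real b) ^ q"
    have "m > 0" "real b = m + 1" using base by (auto simp: m_def)
    moreover from this have "(1 - x / (m + 1)) / (m * M) = (1 / M + (1 - x) / (m * M)) / (m + 1)"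
      if "M > 0" for M
      using that by (simp add: field_simps)
    ultimately show ?thesis
      unfolding T_def power_Suc m_def[symmetric] x_def[symmetric] by simp
  qed
  have step: "lower_limit_ge (freq (occurs l u (Suc k) c)) (T q / real b ^ l)"
    if "\<And>j. j \<in> {1..l} \<Longrightarrow> u j < b" for q l u
    using that
  proof (induction q arbitrary: l u)
    case 0
    show ?case
      by (rule lower_limit_ge_mono[OF tendsto_imp_lower_limit_ge[of "\<lambda>_. 0"]])
        (simp_all add: T_def freq_nonneg)
  next
    case (Suc q)
    \<comment> \<open>The next digit is \<open>c 1\<close>, leaving a shorter word for the outer
      induction, or b - 1, leaving the whole word with one step fewer. Both lengthen the prefix,
      hence the generality in l and u.\<close>
    let ?P = "occurs (Suc l) (u(Suc l := c 1)) k (\<lambda>j. c (Suc j))"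
    let ?Q = "occurs (Suc l) (u(Suc l := b - 1)) (Suc k) c"
    have "lower_limit_ge (freq ?P) (1 / real (b - 1) ^ k / real b ^ Suc l)"
      using Suc.prems less_le_trans[OF c1, of b] c_digit by (intro tail_bound) auto
    moreover have "lower_limit_ge (freq ?Q) (T q / real b ^ Suc l)"
      using Suc.prems base by (intro Suc.IH) auto
    ultimately have "lower_limit_ge (\<lambda>N. freq ?P N + freq ?Q N)
        (1 / real (b - 1) ^ k / real b ^ Suc l + T q / real b ^ Suc l)"
      by (rule lower_limit_ge_add)
    also have "1 / real (b - 1) ^ k / real b ^ Suc l + T q / real b ^ Suc l
        = T (Suc q) / real b ^ l"
      using base by (simp add: T_Suc add_divide_distrib)
    finally show ?case
    proof (rule lower_limit_ge_mono, intro always_eventually allI)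
      fix N
      have "\<not> (?P i \<and> ?Q i)" for i
        using occurs_last[of l u "c 1"] occurs_last[of l u "b - 1"] c1 by (metis less_irrefl)
      then have "freq ?P N + freq ?Q N = freq (\<lambda>i. ?P i \<or> ?Q i) N" by (rule freq_disj[symmetric])
      also have "\<dots> \<le> freq (occurs l u (Suc k) c) N"
        using c1 by (intro freq_mono) (auto intro: occurs_kept occurs_removed)
      finally show "freq ?P N + freq ?Q N \<le> freq (occurs l u (Suc k) c) N" .
    qed
  qed
  have "(\<lambda>q. T q / real b ^ l) \<longlonglongrightarrow> (1 - 0) / real (b - 1) ^ Suc k / real b ^ l"
    unfolding T_def using base by (intro tendsto_intros LIMSEQ_power_zero) auto
  then have "(\<lambda>q. T q / real b ^ l) \<longlonglongrightarrow> 1 / real (b - 1) ^ Suc k / real b ^ l"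
    by simp
  with step[OF Suc.prems(2)] show ?case by (rule lower_limit_ge_closed)
qed

section \<open>Density of the survivors and growth of the enumeration\<close>

lemma kept_upto_density: "(\<lambda>N. real (kept_upto N) / real N) \<longlonglongrightarrow> real (b - 1) / real b"
proof -
  \<comment> \<open>Each of the b - 1 surviving digits contributes density 1 / b.\<close>
  have "(\<lambda>N. \<Sum>x\<in>{..<b - 1}. freq (\<lambda>i. a (Suc i) = x) N) \<longlonglongrightarrow> (\<Sum>x\<in>{..<b - 1}. 1 / real b)"
  proof (rule tendsto_sum)
    fix x assume "x \<in> {..<b - 1}"
    then show "freq (\<lambda>i. a (Suc i) = x) \<longlonglongrightarrow> 1 / real b"
      using normal_to_base_freq[OF normal, of 1 "\<lambda>_. x"] by auto
  qed
  moreover have "(\<Sum>x\<in>{..<b - 1}. freq (\<lambda>i. a (Suc i) = x) N) = real (kept_upto N) / real N" for N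
    by (subst freq_Bex[symmetric]) (auto simp: freq_def kept_upto_def)
  ultimately show ?thesis by simp
qed

lemma filterlim_n: "filterlim n sequentially sequentially"
proof (rule filterlim_at_top_mono[OF filterlim_ident])
  have "j \<le> n j" if "1 \<le> j" for j
    using that
  proof (induction j rule: dec_induct)
    case base
    have "n 1 \<in> n ` {1..}" by simp
    then show ?case by (simp add: n_image)
  next
    case (step j)
    then show ?case using n_mono[of j "Suc j"] by linarith
  qed
  then show "\<forall>\<^sub>F j in sequentially. j \<le> n j"
    by (intro eventually_sequentiallyI[of 1])
qed

text \<open>Evaluate the survivor density along the positions \<open>n N\<close>, where the count is
  N, and invert.\<close>

lemma n_growth: "(\<lambda>N. real (n N) / real N) \<longlonglongrightarrow> real b / real (b - 1)"
proof -
  have "(\<lambda>N. real (kept_upto (n N)) / real (n N)) \<longlonglongrightarrow> real (b - 1) / real b"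
    using filterlim_compose[OF kept_upto_density filterlim_n] by simp
  then have "(\<lambda>N. inverse (real (kept_upto (n N)) / real (n N)))
      \<longlonglongrightarrow> inverse (real (b - 1) / real b)"
    using base by (intro tendsto_inverse) auto
  then have "(\<lambda>N. real (n N) / real (kept_upto (n N))) \<longlonglongrightarrow> real b / real (b - 1)"
    by simp
  \<comment> \<open>\<open>kept_upto (n N) = N\<close> is available for N \<ge> 1 only;
    \<open>n 0\<close> is arbitrary.\<close>
  moreover have "\<forall>\<^sub>F N in sequentially.
      real (n N) / real (kept_upto (n N)) = real (n N) / real N"
    using eventually_ge_at_top[of 1] by eventually_elim (simp add: kept_upto_n)
  ultimately show ?thesis by (rule Lim_transform_eventually)
qed

section \<open>Transfer to the reduced sequence\<close>

lemma card_occurs_le: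
  assumes "1 \<le> N" and "c 1 < b - 1"
  shows "card {i. i < n N \<and> occurs 1 (\<lambda>_. c 1) k (\<lambda>j. c (Suc j)) i}
    \<le> card {i. i < N \<and> (\<forall>j\<in>{1..Suc k}. a (n (i + j)) = c j)}"
\<comment> \<open>\<open>kept_upto\<close> sends a position to its index in the reduced sequence.
  The prefix \<open>c 1\<close> forces a survivor right after i, so i is recovered from its index;
  without it, a run of deleted digits would be counted repeatedly.\<close>
proof (rule card_inj_on_le[where f = kept_upto])
  let ?A = "{i. i < n N \<and> occurs 1 (\<lambda>_. c 1) k (\<lambda>j. c (Suc j)) i}"
  have kept: "n (Suc (kept_upto i)) = Suc i" if "i \<in> ?A" for i
    using that assms(2) by (intro n_kept_upto) (auto simp: occurs_def)
  show "inj_on kept_upto ?A" by (rule inj_onI) (metis kept Suc_inject)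
  show "kept_upto ` ?A \<subseteq> {i. i < N \<and> (\<forall>j\<in>{1..Suc k}. a (n (i + j)) = c j)}"
  proof (intro image_subsetI CollectI conjI)
    fix i assume i: "i \<in> ?A"
    then have "\<not> n N < n (Suc (kept_upto i))" using kept by simp
    then show "kept_upto i < N" using n_less_iff[of N "Suc (kept_upto i)"] assms(1) by simp
    \<comment> \<open>With l = 0, the prefix letter is merged back into the word.\<close>
    have "occurs 0 (\<lambda>_. c 1) (Suc k) c i"
      using i assms(2) by (intro occurs_kept) (auto simp: fun_upd_idem)
    then show "\<forall>j\<in>{1..Suc k}. a (n (kept_upto i + j)) = c j" by (simp add: occurs_def)
  qed
qed simp

text \<open>Counting up to \<open>n N\<close> but dividing by N multiplies the density 1 / ((b -
  1)^(k - 1) * b) by the limit b / (b - 1) of n N / N.\<close>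

lemma reduced_lower_density:
  assumes "1 \<le> k" and "\<And>j. j \<in> {1..k} \<Longrightarrow> c j < b - 1"
  shows "lower_limit_ge (freq (\<lambda>i. \<forall>j\<in>{1..k}. a (n (i + j)) = c j)) (1 / real (b - 1) ^ k)"
proof -
  obtain k' where k: "k = Suc k'" using assms(1) by (cases k) auto
  have c1: "c 1 < b - 1" using assms by simp
  let ?P = "occurs 1 (\<lambda>_. c 1) k' (\<lambda>j. c (Suc j))"
  have "lower_limit_ge (freq ?P) (1 / real (b - 1) ^ k' / real b ^ 1)"
    using assms(2) less_le_trans[OF c1, of b] by (intro occurs_lower_density) (auto simp: k)
  then have "lower_limit_ge (\<lambda>N. freq ?P (n N)) (1 / real (b - 1) ^ k' / real b ^ 1)"
    by (rule lower_limit_ge_compose[OF _ filterlim_n])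
  then have "lower_limit_ge (\<lambda>N. freq ?P (n N) * (real (n N) / real N))
      (1 / real (b - 1) ^ k' / real b ^ 1 * (real b / real (b - 1)))"
    using base by (intro lower_limit_ge_mult n_growth) auto
  also have "1 / real (b - 1) ^ k' / real b ^ 1 * (real b / real (b - 1)) = 1 / real (b - 1) ^ k"
    using base by (simp add: k)
  finally show ?thesis
  proof (rule lower_limit_ge_mono)
    show "\<forall>\<^sub>F N in sequentially. freq ?P (n N) * (real (n N) / real N)
        \<le> freq (\<lambda>i. \<forall>j\<in>{1..k}. a (n (i + j)) = c j) N"
      using eventually_ge_at_top[of 1]
    proof eventually_elim
      case (elim N)
      have "freq ?P (n N) * (real (n N) / real N) = real (card {i. i < n N \<and> ?P i}) / real N"
        by (simp add: freq_def)
      also have "\<dots> \<le> freq (\<lambda>i. \<forall>j\<in>{1..k}. a (n (i + j)) = c j) N"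
        using card_occurs_le[of N c k'] elim c1 unfolding freq_def k
        by (intro divide_right_mono) auto
      finally show ?case .
    qed
  qed
qed

lemma digit_seq_reduced: "digit_seq (b - 1) (\<lambda>i. a (n i))"
  using n_image by (auto simp: digit_seq_def)

lemma normal_reduced: "normal_to_base (b - 1) (\<lambda>i. a (n i))"
  unfolding normal_to_base_def
proof (intro conjI allI impI digit_seq_reduced)
  fix k :: nat and c :: "nat \<Rightarrow> nat"
  assume k: "1 \<le> k" and c: "\<forall>j\<in>{1..k}. c j \<in> {0..<b - 1}"
  \<comment> \<open>Words are extensional functions, so agreement on {1..k} is equality and the
    events \<open>P w\<close> are disjoint; c is later restricted to {1..k} to belong to W.\<close>
  define W where "W = (\<Pi>\<^sub>E j\<in>{1..k}. {0..<b - 1})"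
  define P where "P w i \<longleftrightarrow> (\<forall>j\<in>{1..k}. a (n (i + j)) = w j)" for w i
  have "finite W" by (simp add: W_def finite_PiE)
  have "card W = (b - 1) ^ k" by (simp add: W_def card_PiE)
  have total: "(\<Sum>w\<in>W. freq (P w) N) = freq (\<lambda>_. True) N" for N
  proof -
    have "(\<Sum>w\<in>W. freq (P w) N) = freq (\<lambda>i. \<exists>w\<in>W. P w i) N"
    proof (rule freq_Bex[symmetric, OF \<open>finite W\<close>])
      fix i v w assume "v \<in> W" "w \<in> W" "P v i" "P w i"
      then show "v = w" unfolding W_def P_def by (intro PiE_ext) auto
    qed
    also have "(\<lambda>i. \<exists>w\<in>W. P w i) = (\<lambda>_. True)"
    proof
      fix i
      have "(\<lambda>j\<in>{1..k}. a (n (i + j))) \<in> W"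
        using digit_seq_reduced by (auto simp: W_def digit_seq_def)
      moreover have "P (\<lambda>j\<in>{1..k}. a (n (i + j))) i" by (simp add: P_def)
      ultimately show "(\<exists>w\<in>W. P w i) = True" by blast
    qed
    finally show ?thesis .
  qed
  have "freq (P w) \<longlonglongrightarrow> 1 / real (b - 1) ^ k" if "w \<in> W" for w
  \<comment> \<open>The (b - 1)^k lower bounds add up to 1, the limit of the total
    frequency.\<close>
  proof (rule tendsto_of_lower_limit_ge_sum[where f = "\<lambda>w. freq (P w)", OF \<open>finite W\<close> _ _ that])
    fix w assume "w \<in> W"
    then show "lower_limit_ge (freq (P w)) (1 / real (b - 1) ^ k)"
      unfolding P_def using k by (intro reduced_lower_density) (auto simp: W_def)
  next
    show "(\<lambda>N. \<Sum>w\<in>W. freq (P w) N) \<longlonglongrightarrow> (\<Sum>w\<in>W. 1 / real (b - 1) ^ k)"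
      using freq_True base by (simp add: total \<open>card W = _\<close>)
  qed
  from this[of "restrict c {1..k}"]
  have "freq (P (restrict c {1..k})) \<longlonglongrightarrow> 1 / real (b - 1) ^ k"
    using c by (auto simp: W_def)
  then show "(\<lambda>N. real (card {i. i < N \<and> (\<forall>j\<in>{1..k}. a (n (i + j)) = c j)}) / real N)
      \<longlonglongrightarrow> 1 / real (b - 1) ^ k"
    by (simp add: P_def[abs_def] freq_def[abs_def])
qed

end

section \<open>Existence of the enumeration\<close>

lemma normal_infinite_kept:
  assumes "b \<ge> 2" and "normal_to_base b a"
  shows "infinite {m. m \<ge> 1 \<and> 0 \<le> a m \<and> a m < b - 1}" (is "infinite ?S")
proof
  assume "finite ?S"
  \<comment> \<open>The digit 0 survives because b \<ge> 2; finitely many zeros would have frequency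
    0, against 1 / b from normality.\<close>
  then have "finite {i. a (Suc i) = 0}"
    using assms(1) by (intro finite_imageD[of Suc "{i. a (Suc i) = 0}"])
      (auto intro: finite_subset[of _ ?S])
  have "freq (\<lambda>i. a (Suc i) = 0) \<longlonglongrightarrow> 0"
  proof (rule tendsto_sandwich[OF _ _ tendsto_const lim_const_over_n])
    show "\<forall>\<^sub>F N in sequentially. freq (\<lambda>i. a (Suc i) = 0) N
        \<le> real (card {i. a (Suc i) = 0}) / real N"
      unfolding freq_def using \<open>finite {i. a (Suc i) = 0}\<close>
      by (intro always_eventually allI divide_right_mono) (auto intro: card_mono)
  qed (simp add: freq_nonneg)
  moreover have "freq (\<lambda>i. a (Suc i) = 0) \<longlonglongrightarrow> 1 / real b"
    using normal_to_base_freq[OF assms(2), of 1 "\<lambda>_. 0"] assms(1) by simp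
  ultimately have "1 / real b = 0" by (rule LIMSEQ_unique[rotated])
  with assms(1) show False by simp
qed

text \<open>\<open>enumerate\<close> starts at index 0, hence the shift by one; the truncated 0 - 1
  = 0 repeats the first element at index 0, outside {1..}.\<close>

lemma increasing_enumeration_enumerate:
  assumes "infinite S"
  shows "increasing_enumeration (\<lambda>i. enumerate S (i - 1)) S"
proof -
  have "(\<lambda>i. enumerate S (i - 1)) ` {1..} = enumerate S ` ((\<lambda>i. i - 1) ` {1..})"
    by (simp add: image_image)
  also have "(\<lambda>i::nat. i - 1) ` {1..} = UNIV"
    by (auto intro: image_eqI[of _ _ "Suc i" for i])
  also have "enumerate S ` UNIV = S" by (rule range_enumerate[OF assms])
  finally show ?thesis
    using assms by (auto simp: increasing_enumeration_def strict_mono_on_def intro!: enumerate_mono)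
qed

text \<open>The existence conjunct keeps the universal one from holding vacuously.\<close>

theorem theorem1p2:
  fixes b :: nat and a :: "nat \<Rightarrow> nat"
  assumes "b \<ge> 2"
    and "normal_to_base b a"
  shows "(\<exists>n. increasing_enumeration n {m. m \<ge> 1 \<and> 0 \<le> a m \<and> a m < b - 1}) \<and>
    (\<forall>n. increasing_enumeration n {m. m \<ge> 1 \<and> 0 \<le> a m \<and> a m < b - 1} \<longrightarrow>
       normal_to_base (b - 1) (\<lambda>i. a (n i)))"
proof (intro conjI allI impI)
  show "\<exists>n. increasing_enumeration n {m. m \<ge> 1 \<and> 0 \<le> a m \<and> a m < b - 1}"
    using increasing_enumeration_enumerate[OF normal_infinite_kept[OF assms]] by blast
next
  fix n assume "increasing_enumeration n {m. m \<ge> 1 \<and> 0 \<le> a m \<and> a m < b - 1}"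
  then interpret reduced_sequence b a n
    using assms by unfold_locales
  show "normal_to_base (b - 1) (\<lambda>i. a (n i))" by (rule normal_reduced)
qed

end
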